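(* Let $X$ be a finite set with $n$ elements, $n\geq 1$. Then: (1) The maximum cardinality of a semilattice in $T(X)$ is $2^{n-1}$. (2) There are exactly $n$ semilattices in $T(X)$ of cardinality $2^{n-1}$, namely the semilattices $E_t$ ($t\in X$). (3) Each semilattice $E_t$ ($t\in X$) is isomorphic to the semilattice of idempotents of the symmetric inverse semigroup $I(X')$, where $X'$ is a set with $|X'|=n-1$.
   Context: $T(X)$ denotes the semigroup of all functions from $X$ to $X$ under composition. Functions are written on the right and composed from left to right: $x(fg)=(xf)g$. A semilattice is a commutative semigroup consisting entirely of idempotents; a "semilattice in $T(X)$" means a subsemigroup of $T(X)$ that is a semilattice. For $t\in X$ let $X_t=X-\{t\}$. For $A\subseteq X_t$ (possibly empty), let $e_A\in T(X)$ be the transformation with $xe_A=x$ if $x\in A$ and $xe_A=t$ if $x\in X-A$. Define $E_t=\{e_A : A\subseteq X_t\}\subseteq T(X)$. For a set $Y$, $I(Y)$ denotes the symmetric inverse semigroup on $Y$: all partial one-to-one transformations on $Y$ (one-to-one functions whose domain and image are contained in $Y$) under composition of partial functions. Its idempotents are exactly the partial identities, i.e. the restrictions of the identity to subsets of $Y$, and they form a semilattice. By convention $I(\emptyset)=\{0\}$ (a one-element semigroup). *)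

theory Defs
  imports "HOL-Algebra.Group"
begin

text \<open>
  Semigroups are represented by their carrier and multiplication in a
  \<^type>\<open>monoid_ext\<close> record, so that \<^const>\<open>iso\<close> and \<^const>\<open>is_iso\<close>
  (which only refer to these two fields) are semigroup isomorphism.
  A subsemigroup on a subset \<open>S\<close> is \<open>G\<lparr>carrier := S\<rparr>\<close>; its \<open>one\<close> field is
  irrelevant and \<open>S\<close> need not contain it.
\<close>

definition idempotents :: "('a, 'm) monoid_scheme \<Rightarrow> 'a set" where
  "idempotents G = {x \<in> carrier G. x \<otimes>\<^bsub>G\<^esub> x = x}"

definition is_semigroup :: "('a, 'm) monoid_scheme \<Rightarrow> bool" where
  "is_semigroup G \<longleftrightarrow>
    (\<forall>x\<in>carrier G. \<forall>y\<in>carrier G. x \<otimes>\<^bsub>G\<^esub> y \<in> carrier G) \<and>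
    (\<forall>x\<in>carrier G. \<forall>y\<in>carrier G. \<forall>z\<in>carrier G.
      (x \<otimes>\<^bsub>G\<^esub> y) \<otimes>\<^bsub>G\<^esub> z = x \<otimes>\<^bsub>G\<^esub> (y \<otimes>\<^bsub>G\<^esub> z))"

definition is_semilattice :: "('a, 'm) monoid_scheme \<Rightarrow> bool" where
  "is_semilattice G \<longleftrightarrow>
    is_semigroup G \<and>
    (\<forall>x\<in>carrier G. \<forall>y\<in>carrier G. x \<otimes>\<^bsub>G\<^esub> y = y \<otimes>\<^bsub>G\<^esub> x) \<and>
    idempotents G = carrier G"

definition semilattices_in :: "('a, 'm) monoid_scheme \<Rightarrow> 'a set set" where
  "semilattices_in G = {S. S \<subseteq> carrier G \<and> is_semilattice (G\<lparr>carrier := S\<rparr>)}"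

text \<open>
  The semigroup \<open>T(X)\<close>. Functions \<open>X \<rightarrow> X\<close> are extensional (\<open>undefined\<close> outside
  \<open>X\<close>), so each is represented exactly once. As functions are written on the
  right, \<open>f \<otimes> g\<close> applies \<open>f\<close> first.
\<close>

definition full_transf :: "'a set \<Rightarrow> ('a \<Rightarrow> 'a) monoid" where
  "full_transf X =
    \<lparr>carrier = X \<rightarrow>\<^sub>E X, mult = (\<lambda>f g. compose X g f), one = (\<lambda>x\<in>X. x)\<rparr>"

text \<open>
  The symmetric inverse semigroup \<open>I(Y)\<close>; a partial transformation is a map
  with domain \<^const>\<open>dom\<close> and image \<^const>\<open>ran\<close>, and again \<open>f \<otimes> g\<close> applies
  \<open>f\<close> first. For \<open>Y = {}\<close> the only element is the empty map.
\<close>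

definition sym_inverse :: "'b set \<Rightarrow> ('b \<Rightarrow> 'b option) monoid" where
  "sym_inverse Y =
    \<lparr>carrier = {f. dom f \<subseteq> Y \<and> ran f \<subseteq> Y \<and> inj_on f (dom f)},
     mult = (\<lambda>f g. g \<circ>\<^sub>m f), one = Some |` Y\<rparr>"

definition e_transf :: "'a set \<Rightarrow> 'a \<Rightarrow> 'a set \<Rightarrow> 'a \<Rightarrow> 'a" where
  "e_transf X t A = (\<lambda>x\<in>X. if x \<in> A then x else t)"

definition E_family :: "'a set \<Rightarrow> 'a \<Rightarrow> ('a \<Rightarrow> 'a) set" where
  "E_family X t = {e_transf X t A | A. A \<subseteq> X - {t}}"

end

theory Submission
  imports Defs
begin

text \<open>
  The proof follows the sets of fixed points, which for an idempotent are the same as images.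
  If two idempotents commute, their product fixes exactly the points fixed by both, and if
  moreover they fix the same points, they are equal.  So \<open>f \<mapsto> fixed_points X f\<close> embeds a semilattice
  \<open>S\<close> into the subsets of \<open>X\<close> under intersection.  An idempotent on a nonempty set has a fixed
  point, hence the least of these sets is nonempty: there is a point \<open>t\<close> fixed by all of \<open>S\<close>, and
  \<open>S\<close> embeds into the \<open>2 ^ (n - 1)\<close> sets that contain \<open>t\<close>.

  When the bound is attained, every subset of \<open>X\<close> containing \<open>t\<close> occurs.  In particular, for each \<open>x \<noteq> t\<close>
  some \<open>g \<in> S\<close> fixes only \<open>x\<close> and \<open>t\<close>.  For \<open>f \<in> S\<close> moving \<open>x\<close>, the product of \<open>f\<close> and \<open>g\<close>
  then has \<open>t\<close> as its only fixed point, and it takes \<open>x\<close> to \<open>f x\<close>; so \<open>f x = t\<close>.  Thus every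
  member of \<open>S\<close> sends each point either to itself or to \<open>t\<close>, that is, \<open>S = E_family X t\<close>.

  Both \<open>E_family X t\<close> and the semilattice of partial identities on \<open>X'\<close> are copies of a power set
  under intersection, of \<open>X - {t}\<close> and of \<open>X'\<close> respectively, and a bijection between these two
  sets of size \<open>n - 1\<close> gives the isomorphism.
\<close>

section \<open>Commuting idempotents and their fixed points\<close>

definition fixed_points :: "'a set \<Rightarrow> ('a \<Rightarrow> 'a) \<Rightarrow> 'a set" where
  "fixed_points X f = {x \<in> X. f x = x}"

lemma semilattices_in_full_transf_iff:
  "S \<in> semilattices_in (full_transf X) \<longleftrightarrow>
    S \<subseteq> X \<rightarrow>\<^sub>E X \<and>
    (\<forall>f\<in>S. \<forall>g\<in>S. compose X f g \<in> S \<and> compose X f g = compose X g f) \<and>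
    (\<forall>f\<in>S. compose X f f = f)"
proof -
  have "compose X h (compose X g f) = compose X (compose X h g) f"
    if "S \<subseteq> X \<rightarrow>\<^sub>E X" "f \<in> S" for f g h
    using that by (intro compose_assoc) (auto simp: PiE_def)
  then show ?thesis
    unfolding semilattices_in_def is_semilattice_def is_semigroup_def idempotents_def full_transf_def
    by auto
qed

lemma semilattice_transf:
  assumes "S \<in> semilattices_in (full_transf X)" "f \<in> S"
  shows "f \<in> X \<rightarrow>\<^sub>E X"
  using assms by (auto simp: semilattices_in_full_transf_iff)

lemma semilattice_maps_to:
  assumes "S \<in> semilattices_in (full_transf X)" "f \<in> S" "x \<in> X"
  shows "f x \<in> X"
  using semilattice_transf[OF assms(1,2)] assms(3) by auto

lemma semilattice_closed:
  assumes "S \<in> semilattices_in (full_transf X)" "f \<in> S" "g \<in> S"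
  shows "compose X f g \<in> S"
  using assms by (auto simp: semilattices_in_full_transf_iff)

lemma semilattice_commute:
  assumes "S \<in> semilattices_in (full_transf X)" "f \<in> S" "g \<in> S" "x \<in> X"
  shows "f (g x) = g (f x)"
proof -
  have "compose X f g x = compose X g f x"
    using assms(1-3) by (simp add: semilattices_in_full_transf_iff)
  then show ?thesis
    using assms(4) by (simp add: compose_eq)
qed

lemma semilattice_idem:
  assumes "S \<in> semilattices_in (full_transf X)" "f \<in> S" "x \<in> X"
  shows "f (f x) = f x"
proof -
  have "compose X f f x = f x"
    using assms(1,2) by (simp add: semilattices_in_full_transf_iff)
  then show ?thesis
    using assms(3) by (simp add: compose_eq)
qed

lemma semilattice_value_fixed:
  assumes "S \<in> semilattices_in (full_transf X)" "f \<in> S" "x \<in> X"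
  shows "f x \<in> fixed_points X f"
  using semilattice_maps_to[OF assms] semilattice_idem[OF assms]
  by (simp add: fixed_points_def)

text \<open>
  A point \<open>x\<close> fixed by the product is a value of \<open>f\<close>, hence fixed by the idempotent \<open>f\<close>; by
  commutativity it is a value of \<open>g\<close> as well.
\<close>

lemma fixed_points_compose:
  assumes S: "S \<in> semilattices_in (full_transf X)" and f: "f \<in> S" and g: "g \<in> S"
  shows "fixed_points X (compose X f g) = fixed_points X f \<inter> fixed_points X g"
proof
  show "fixed_points X (compose X f g) \<subseteq> fixed_points X f \<inter> fixed_points X g"
  proof
    fix x assume "x \<in> fixed_points X (compose X f g)"
    then have x: "x \<in> X" "f (g x) = x"
      by (auto simp: fixed_points_def compose_eq)
    then have "g (f x) = x"
      using semilattice_commute[OF S f g] by simp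
    then show "x \<in> fixed_points X f \<inter> fixed_points X g"
      using x semilattice_value_fixed[OF S f semilattice_maps_to[OF S g]]
        semilattice_value_fixed[OF S g semilattice_maps_to[OF S f]]
      by (metis IntI)
  qed
qed (auto simp: fixed_points_def compose_eq)

text \<open>
  If \<open>f\<close> and \<open>g\<close> fix the same points, then \<open>g\<close> fixes the values of \<open>f\<close> and vice versa, so both are
  equal to their product.
\<close>

lemma inj_on_fixed_points:
  assumes S: "S \<in> semilattices_in (full_transf X)"
  shows "inj_on (fixed_points X) S"
proof (rule inj_onI)
  fix f g assume f: "f \<in> S" and g: "g \<in> S" and eq: "fixed_points X f = fixed_points X g"
  show "f = g"
  proof (rule PiE_ext[OF semilattice_transf[OF S f] semilattice_transf[OF S g]])
    fix x assume x: "x \<in> X"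
    have "g (f x) = f x" "f (g x) = g x"
      using semilattice_value_fixed[OF S f x] semilattice_value_fixed[OF S g x] eq
      by (auto simp: fixed_points_def)
    then show "f x = g x"
      using semilattice_commute[OF S f g x] by simp
  qed
qed

section \<open>The bound and the extremal semilattices\<close>

text \<open>
  Among the members of \<open>S\<close> take \<open>f\<close> with the fewest fixed points.  Multiplying \<open>f\<close> by any \<open>g \<in> S\<close>
  cannot lose any of them, so all points fixed by \<open>f\<close> are fixed by \<open>g\<close>; and \<open>f\<close> has a fixed point
  because it is idempotent.
\<close>

lemma semilattice_common_fixed_point:
  assumes X: "finite X" "X \<noteq> {}" and S: "S \<in> semilattices_in (full_transf X)"
  obtains t where "t \<in> X" "\<forall>f\<in>S. f t = t"
proof (cases "S = {}")
  case True
  then show ?thesis using X(2) that by blast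
next
  case False
  then obtain f where f: "f \<in> S"
    and min: "\<And>g. g \<in> S \<Longrightarrow> card (fixed_points X f) \<le> card (fixed_points X g)"
    using exists_least_iff[of "\<lambda>k. \<exists>f\<in>S. card (fixed_points X f) = k"]
    by (metis ex_in_conv linorder_not_le)
  obtain x where "x \<in> X" using X(2) by blast
  then have t: "f x \<in> fixed_points X f"
    by (rule semilattice_value_fixed[OF S f])
  show ?thesis
  proof (rule that; (rule ballI)?)
    show "f x \<in> X" using t by (simp add: fixed_points_def)
    fix g assume g: "g \<in> S"
    have "card (fixed_points X f) \<le> card (fixed_points X f \<inter> fixed_points X g)"
      using min[OF semilattice_closed[OF S f g]] by (simp only: fixed_points_compose[OF S f g])
    then have "fixed_points X f \<inter> fixed_points X g = fixed_points X f"
      using X(1) by (intro card_seteq) (auto simp: fixed_points_def)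
    then show "g (f x) = f x"
      using t by (auto simp: fixed_points_def)
  qed
qed

text \<open>
  The sets containing \<open>t\<close> correspond to the subsets of \<open>X - {t}\<close>; stripping \<open>t\<close> makes the target a
  power set.
\<close>

lemma semilattice_embeds_in_Pow:
  assumes S: "S \<in> semilattices_in (full_transf X)" and t: "t \<in> X" "\<forall>f\<in>S. f t = t"
  shows "inj_on (\<lambda>f. fixed_points X f - {t}) S"
    and "(\<lambda>f. fixed_points X f - {t}) ` S \<subseteq> Pow (X - {t})"
proof -
  have "t \<in> fixed_points X f" if "f \<in> S" for f
    using t(1) bspec[OF t(2) that] by (simp add: fixed_points_def)
  then have strip: "fixed_points X f = fixed_points X g"
    if "f \<in> S" "g \<in> S" "fixed_points X f - {t} = fixed_points X g - {t}" for f g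
    using that by (metis insert_Diff)
  show "inj_on (\<lambda>f. fixed_points X f - {t}) S"
    by (rule inj_onI) (rule inj_onD[OF inj_on_fixed_points[OF S] strip])
qed (auto simp: fixed_points_def)

lemma card_semilattice_le:
  assumes X: "finite X" "X \<noteq> {}" and S: "S \<in> semilattices_in (full_transf X)"
  shows "card S \<le> 2 ^ (card X - 1)"
proof -
  obtain t where t: "t \<in> X" "\<forall>f\<in>S. f t = t"
    by (rule semilattice_common_fixed_point[OF X S])
  have "card S \<le> card (Pow (X - {t}))"
    using semilattice_embeds_in_Pow[OF S t] by (rule card_inj_on_le) (simp add: X(1))
  then show ?thesis
    using X(1) t(1) by (simp add: card_Pow)
qed

lemma bij_betw_e_transf:
  "bij_betw (e_transf X t) (Pow (X - {t})) (E_family X t)"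
proof -
  have "fixed_points X (e_transf X t A) - {t} = A" if "A \<subseteq> X - {t}" for A
    using that by (auto simp: fixed_points_def e_transf_def)
  then have "inj_on (e_transf X t) (Pow (X - {t}))"
    by (intro inj_on_inverseI[where g = "\<lambda>f. fixed_points X f - {t}"]) auto
  then show ?thesis
    by (auto simp: bij_betw_def E_family_def)
qed

lemma card_E_family:
  assumes "finite X" "t \<in> X"
  shows "card (E_family X t) = 2 ^ (card X - 1)"
  using bij_betw_same_card[OF bij_betw_e_transf[of X t]] assms by (simp add: card_Pow)

lemma compose_e_transf:
  assumes "t \<in> X" "A \<subseteq> X - {t}" "B \<subseteq> X - {t}"
  shows "compose X (e_transf X t A) (e_transf X t B) = e_transf X t (A \<inter> B)"
  using assms by (auto simp: compose_def e_transf_def fun_eq_iff)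

lemma E_family_semilattice:
  assumes "t \<in> X"
  shows "E_family X t \<in> semilattices_in (full_transf X)"
  unfolding semilattices_in_full_transf_iff
proof (intro conjI ballI)
  show "E_family X t \<subseteq> X \<rightarrow>\<^sub>E X"
    using assms by (auto simp: E_family_def e_transf_def)
next
  fix f g assume "f \<in> E_family X t" "g \<in> E_family X t"
  then obtain A B where A: "A \<subseteq> X - {t}" "f = e_transf X t A"
    and B: "B \<subseteq> X - {t}" "g = e_transf X t B"
    by (auto simp: E_family_def)
  then have "compose X f g = e_transf X t (A \<inter> B)" "compose X g f = e_transf X t (A \<inter> B)"
    using assms by (simp_all add: compose_e_transf Int_commute)
  moreover have "A \<inter> B \<subseteq> X - {t}" using A by blast
  ultimately show "compose X f g \<in> E_family X t" "compose X f g = compose X g f"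
    by (auto simp: E_family_def)
next
  fix f assume "f \<in> E_family X t"
  then show "compose X f f = f"
    using assms by (auto simp: E_family_def compose_e_transf)
qed

lemma semilattice_of_max_card:
  assumes X: "finite X" "X \<noteq> {}" and S: "S \<in> semilattices_in (full_transf X)"
    and card: "card S = 2 ^ (card X - 1)"
  shows "\<exists>t\<in>X. S = E_family X t"
proof -
  obtain t where t: "t \<in> X" "\<forall>f\<in>S. f t = t"
    by (rule semilattice_common_fixed_point[OF X S])
  let ?F = "\<lambda>f. fixed_points X f - {t}"
  have "card (?F ` S) = card (Pow (X - {t}))"
    using semilattice_embeds_in_Pow(1)[OF S t] card X(1) t(1) by (simp add: card_image card_Pow)
  then have surj: "?F ` S = Pow (X - {t})"
    using semilattice_embeds_in_Pow(2)[OF S t] X(1) by (intro card_subset_eq) simp_all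
  have to_t: "f x = t" if f: "f \<in> S" and x: "x \<in> X" "f x \<noteq> x" for f x
  proof -
    have "x \<noteq> t" using bspec[OF t(2) f] x(2) by auto
    then have "{x} \<in> ?F ` S" using surj x(1) by simp
    then obtain g where g: "g \<in> S" "?F g = {x}" by blast
    then have gx: "g x = x" by (auto simp: fixed_points_def)
    have "compose X f g x \<in> fixed_points X f \<inter> fixed_points X g"
      using semilattice_value_fixed[OF S semilattice_closed[OF S f g(1)] x(1)]
      by (simp only: fixed_points_compose[OF S f g(1)])
    then have "f x \<in> fixed_points X f" "f x \<in> fixed_points X g"
      using gx x(1) by (simp_all add: compose_eq)
    moreover have "fixed_points X g \<subseteq> {x, t}"
      using g(2) by blast
    ultimately show "f x = t"
      using x(2) by blast
  qed
  have "S \<subseteq> E_family X t"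
  proof
    fix f assume f: "f \<in> S"
    have "f = e_transf X t (?F f)"
    proof (rule ext)
      fix x
      show "f x = e_transf X t (?F f) x"
      proof (cases "x \<in> X")
        case True
        then show ?thesis
          using to_t[OF f True] by (cases "f x = x") (simp_all add: e_transf_def fixed_points_def)
      next
        case False
        then show ?thesis
          using PiE_arb[OF semilattice_transf[OF S f] False] by (simp add: e_transf_def)
      qed
    qed
    moreover have "?F f \<subseteq> X - {t}" by (auto simp: fixed_points_def)
    ultimately show "f \<in> E_family X t" by (auto simp: E_family_def)
  qed
  moreover have "finite (E_family X t)"
    using bij_betw_finite[OF bij_betw_e_transf[of X t]] X(1) by simp
  ultimately have "S = E_family X t"
    using card card_E_family[OF X(1) t(1)] by (intro card_subset_eq) simp_all
  then show ?thesis using t(1) by blast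
qed

text \<open>
  \<open>t\<close> can be recovered from \<open>E_family X t\<close>: it is the value of the constant map
  \<open>e_transf X t {}\<close>, and a member of \<open>E_family X s\<close> always fixes \<open>s\<close>.
\<close>

lemma inj_on_E_family: "inj_on (E_family X) X"
proof (rule inj_onI)
  fix s t assume st: "s \<in> X" "t \<in> X" and eq: "E_family X s = E_family X t"
  have "e_transf X t {} \<in> E_family X s"
    unfolding eq by (auto simp: E_family_def)
  then obtain A where A: "A \<subseteq> X - {s}" "e_transf X t {} = e_transf X s A"
    by (auto simp: E_family_def)
  have "e_transf X t {} s = s"
    unfolding A(2) using st by (simp add: e_transf_def)
  then show "s = t"
    using st by (simp add: e_transf_def)
qed

section \<open>Isomorphism with the partial identities\<close>

definition Pow_semilattice :: "'a set \<Rightarrow> 'a set monoid" where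
  "Pow_semilattice Y = \<lparr>carrier = Pow Y, mult = (\<inter>), one = Y\<rparr>"

lemma Pow_semilattice_iso_E_family:
  assumes "t \<in> X"
  shows "e_transf X t \<in> iso (Pow_semilattice (X - {t})) ((full_transf X)\<lparr>carrier := E_family X t\<rparr>)"
  unfolding iso_def hom_def Pow_semilattice_def full_transf_def
  using bij_betw_e_transf[of X t] assms
  by (auto simp: compose_e_transf Int_commute bij_betw_def)

lemma restrict_map_Some_eq: "Some |` A = (\<lambda>x. if x \<in> A then Some x else None)"
  by (simp add: fun_eq_iff restrict_map_def)

text \<open>
  If \<open>f\<close> is an idempotent of \<open>I(Y)\<close> and \<open>f x = Some y\<close>, then also \<open>f y = Some y\<close>, and injectivity
  forces \<open>x = y\<close>.
\<close>

lemma idempotents_sym_inverse: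
  "idempotents (sym_inverse Y) = (\<lambda>B. Some |` B) ` Pow Y"
proof
  show "idempotents (sym_inverse Y) \<subseteq> (\<lambda>B. Some |` B) ` Pow Y"
  proof
    fix f assume "f \<in> idempotents (sym_inverse Y)"
    then have f: "dom f \<subseteq> Y" "inj_on f (dom f)" "f \<circ>\<^sub>m f = f"
      by (auto simp: idempotents_def sym_inverse_def)
    have "x = y" if xy: "f x = Some y" for x y
    proof -
      have "f y = Some y"
        using fun_cong[OF f(3), of x] xy by (simp add: map_comp_def)
      then show "x = y"
        using f(2) xy by (auto simp: inj_on_def dom_def)
    qed
    then have "f x = (Some |` dom f) x" for x
      by (cases "f x") (auto simp: restrict_map_Some_eq dom_def)
    then show "f \<in> (\<lambda>B. Some |` B) ` Pow Y"
      using f(1) by blast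
  qed
next
  show "(\<lambda>B. Some |` B) ` Pow Y \<subseteq> idempotents (sym_inverse Y)"
    by (auto simp: idempotents_def sym_inverse_def restrict_map_Some_eq map_comp_def fun_eq_iff
        inj_on_def dom_def ran_def split: if_splits)
qed

lemma Pow_semilattice_iso_partial_identities:
  "(\<lambda>B. Some |` B) \<in>
    iso (Pow_semilattice Y) ((sym_inverse Y)\<lparr>carrier := idempotents (sym_inverse Y)\<rparr>)"
proof -
  have "inj_on (\<lambda>B. Some |` B :: 'a \<Rightarrow> 'a option) (Pow Y)"
    by (rule inj_on_inverseI[where g = dom]) simp
  moreover have "Some |` (A \<inter> B) = (Some |` B) \<circ>\<^sub>m (Some |` A)" for A B :: "'a set"
    by (auto simp: restrict_map_Some_eq map_comp_def fun_eq_iff)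
  ultimately show ?thesis
    unfolding iso_def hom_def bij_betw_def idempotents_sym_inverse
    by (auto simp: Pow_semilattice_def sym_inverse_def)
qed

lemma Pow_semilattice_iso_image:
  assumes "bij_betw h Y Z"
  shows "(\<lambda>A. h ` A) \<in> iso (Pow_semilattice Y) (Pow_semilattice Z)"
proof -
  have inj: "inj_on h Y"
    using assms by (rule bij_betw_imp_inj_on)
  show ?thesis
    using bij_betw_Pow[OF assms] inj_on_image_Int[OF inj] bij_betw_imp_surj_on[OF assms]
    unfolding iso_def hom_def Pow_semilattice_def by auto
qed

text \<open>
  \<open>h\<close> sends \<open>inv h x \<otimes> inv h y\<close> to \<open>x \<otimes> y\<close>; closure of \<open>G\<close> puts that product where \<open>h\<close> can be
  inverted.
\<close>

lemma is_iso_sym_of_closed: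
  assumes h: "h \<in> iso G H"
    and closed: "\<And>x y. x \<in> carrier G \<Longrightarrow> y \<in> carrier G \<Longrightarrow> x \<otimes>\<^bsub>G\<^esub> y \<in> carrier G"
  shows "H \<cong> G"
proof -
  let ?k = "inv_into (carrier G) h"
  have bij: "bij_betw h (carrier G) (carrier H)"
    and mult: "\<And>x y. x \<in> carrier G \<Longrightarrow> y \<in> carrier G \<Longrightarrow> h (x \<otimes>\<^bsub>G\<^esub> y) = h x \<otimes>\<^bsub>H\<^esub> h y"
    using h by (auto simp: iso_def hom_def)
  have k: "bij_betw ?k (carrier H) (carrier G)"
    by (rule bij_betw_inv_into[OF bij])
  have "?k (x \<otimes>\<^bsub>H\<^esub> y) = ?k x \<otimes>\<^bsub>G\<^esub> ?k y" if "x \<in> carrier H" "y \<in> carrier H" for x y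
  proof -
    have kx: "?k x \<in> carrier G" "?k y \<in> carrier G"
      using k that by (auto simp: bij_betw_def)
    have "h (?k x \<otimes>\<^bsub>G\<^esub> ?k y) = x \<otimes>\<^bsub>H\<^esub> y"
      using mult[OF kx] that bij by (simp add: bij_betw_inv_into_right)
    then show ?thesis
      using bij_betw_inv_into_left[OF bij closed[OF kx]] by simp
  qed
  then have "?k \<in> iso H G"
    using k by (auto simp: iso_def hom_def bij_betw_def)
  then show ?thesis by (auto simp: is_iso_def)
qed

lemma E_family_iso_partial_identities:
  fixes X :: "'a set" and Y :: "'b set"
  assumes "finite X" "t \<in> X" "finite Y" "card Y = card X - 1"
  shows "(full_transf X)\<lparr>carrier := E_family X t\<rparr> \<cong>
    (sym_inverse Y)\<lparr>carrier := idempotents (sym_inverse Y)\<rparr>"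
proof -
  have "card (X - {t}) = card Y"
    using assms by simp
  then obtain h where "bij_betw h (X - {t}) Y"
    using finite_same_card_bij assms(1,3) by blast
  then have "Pow_semilattice (X - {t}) \<cong> Pow_semilattice Y"
    using Pow_semilattice_iso_image by (auto simp: is_iso_def)
  moreover have "(full_transf X)\<lparr>carrier := E_family X t\<rparr> \<cong> Pow_semilattice (X - {t})"
    by (rule is_iso_sym_of_closed[OF Pow_semilattice_iso_E_family[OF assms(2)]])
      (auto simp: Pow_semilattice_def)
  moreover have "Pow_semilattice Y \<cong> (sym_inverse Y)\<lparr>carrier := idempotents (sym_inverse Y)\<rparr>"
    using Pow_semilattice_iso_partial_identities by (auto simp: is_iso_def)
  ultimately show ?thesis
    by (blast intro: iso_trans)
qed

section \<open>Maximum semilattices of transformations\<close>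

theorem corollary5p3:
  fixes X :: "'a set" and n :: nat
  assumes "finite X" and "card X = n" and "n \<ge> 1"
  shows "Max (card ` semilattices_in (full_transf X)) = 2 ^ (n - 1) \<and>
    ({S \<in> semilattices_in (full_transf X). card S = 2 ^ (n - 1)} = E_family X ` X \<and>
     card {S \<in> semilattices_in (full_transf X). card S = 2 ^ (n - 1)} = n) \<and>
    (\<forall>t\<in>X. \<forall>X' :: 'b set. finite X' \<and> card X' = n - 1 \<longrightarrow>
       (full_transf X)\<lparr>carrier := E_family X t\<rparr> \<cong>
       (sym_inverse X')\<lparr>carrier := idempotents (sym_inverse X')\<rparr>)"
proof (intro conjI)
  have X: "finite X" "X \<noteq> {}" using assms by auto
  have "semilattices_in (full_transf X) \<subseteq> Pow (X \<rightarrow>\<^sub>E X)"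
    by (rule subsetI) (simp add: semilattices_in_full_transf_iff)
  then have fin: "finite (semilattices_in (full_transf X))"
    by (rule finite_subset) (simp add: X(1) finite_PiE)
  obtain t where t: "t \<in> X" using X(2) by blast
  show "Max (card ` semilattices_in (full_transf X)) = 2 ^ (n - 1)"
  proof (rule Max_eqI)
    show "2 ^ (n - 1) \<in> card ` semilattices_in (full_transf X)"
      using E_family_semilattice[OF t] card_E_family[OF X(1) t] assms(2) by (metis imageI)
  qed (use fin card_semilattice_le[OF X] assms(2) in auto)
  show extremal: "{S \<in> semilattices_in (full_transf X). card S = 2 ^ (n - 1)} = E_family X ` X"
    using semilattice_of_max_card[OF X] E_family_semilattice[of _ X] card_E_family[OF X(1)] assms(2)
    by blast
  show "card {S \<in> semilattices_in (full_transf X). card S = 2 ^ (n - 1)} = n"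
    unfolding extremal using card_image[OF inj_on_E_family[of X]] assms(2) by simp
  show "\<forall>t\<in>X. \<forall>X' :: 'b set. finite X' \<and> card X' = n - 1 \<longrightarrow>
       (full_transf X)\<lparr>carrier := E_family X t\<rparr> \<cong>
       (sym_inverse X')\<lparr>carrier := idempotents (sym_inverse X')\<rparr>"
    using E_family_iso_partial_identities[OF X(1)] assms(2) by blast
qed

end
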